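(* Let $2\leq r<s$ and $g\geq 3$ be integers. Then the order of any $(r,s;g)$-babi-graph is at least: \begin{itemize} \item $1+s$, if $g=3$; \item $2s$, if $g=4$; \item $1+s+(rs+(s-r)^2-s)\left(1+(r-1)+\ldots+(r-1)^{\frac{g-5}{2}}\right)$, if $g>3$ is odd; \item $2\left(s+(rs+(s-r)^2-2s+1)\left(1+(r-1)+\ldots+(r-1)^{\frac{g-6}{2}}\right)\right)$, if $g>4$ is even. \end{itemize}
   Context: Graphs are finite and simple. The girth of a graph is the length of its shortest cycle; the order of a graph is its number of vertices. For integers $1\leq r\leq s$ and $g\geq 3$, an $(r,s;g)$-balanced biregular graph (for short, $(r,s;g)$-babi-graph) is a graph of girth $g$ whose set of vertex degrees equals $\{r,s\}$ and in which the number of vertices of degree $r$ equals the number of vertices of degree $s$. The sums $1+(r-1)+\ldots+(r-1)^{m}$ denote $\sum_{i=0}^{m}(r-1)^i$. *)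

theory Defs
  imports "Graph_Theory.Graph_Theory" "HOL-Library.Extended_Nat"
begin

text \<open>
  A finite simple graph is a \<open>pair_graph\<close>: each edge is represented by the two opposite
  arcs \<open>(u, v)\<close> and \<open>(v, u)\<close>, with \<open>u \<noteq> v\<close>. The degree of a vertex is therefore its
  \<open>out_degree\<close>.
\<close>

text \<open>
  The library predicate \<open>cycle\<close> also accepts the closed walk \<open>u, v, u\<close> along the two arcs
  of one edge. These are exactly the cycles of length 2 of a \<open>pair_graph\<close> (loops being absent),
  so the cycles of the undirected graph are those of length at least 3. The girth of a graph
  without cycles is \<open>\<infinity>\<close>.
\<close>

definition girth :: "'a pair_pre_digraph \<Rightarrow> enat" where
  "girth G = (INF p \<in> {p. pre_digraph.cycle (with_proj G) p \<and> 3 \<le> length p}. enat (length p))"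

definition babi_graph :: "nat \<Rightarrow> nat \<Rightarrow> nat \<Rightarrow> 'a pair_pre_digraph \<Rightarrow> bool" where
  "babi_graph r s g G \<longleftrightarrow>
     1 \<le> r \<and> r \<le> s \<and> 3 \<le> g \<and>
     pair_graph G \<and>
     girth G = enat g \<and>
     out_degree (with_proj G) ` pverts G = {r, s} \<and>
     card {v \<in> pverts G. out_degree (with_proj G) v = r} =
       card {v \<in> pverts G. out_degree (with_proj G) v = s}"

end

theory Submission
  imports Defs
begin

text \<open>
  The bound is a Moore bound. Seen from a vertex, or from an edge, a graph of girth \<open>g\<close> is a
  tree up to about half of \<open>g\<close>, so its order is at least the number of vertices of that tree. With
  the root at level 0, every inner vertex of the tree below it has at least \<open>r - 1\<close> children. The
  balance condition improves level 2. The vertices of degree \<open>r\<close> are as many as those of degree \<open>s\<close>, so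
  they send at most \<open>r\<close> edges per vertex of degree \<open>s\<close>, and therefore the vertices of degree \<open>s\<close>
  induce a subgraph of average degree at least \<open>s - r\<close> (\<open>sum_inner_degree_ge\<close>).

  For odd \<open>g\<close> the root is a vertex of degree \<open>s\<close> with at least \<open>s - r\<close> neighbours of degree \<open>s\<close>.
  For even \<open>g\<close> it is an edge of the induced subgraph whose two ends have at least \<open>2 (s - r)\<close>
  neighbours of degree \<open>s\<close> altogether: the average of this number over the edges is at least twice
  the average degree, by the inequality between the arithmetic and the quadratic mean
  (\<open>exists_heavy_edge\<close>).

  The tree is represented by the non-backtracking walks that start in the root. These are counted
  exactly by the degrees of their end vertices. In a non-backtracking walk that revisits a vertex,
  a shortest segment that returns to its starting vertex is a cycle of length at least 3. So non-backtracking walks shorter than the girth are paths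
  (\<open>distinct_if_non_backtracking\<close>), and two short walks from the same root with the same end
  coincide, since they would otherwise combine into a closed non-backtracking walk
  (\<open>non_backtracking_walk_unique\<close>). Hence each walk of the tree contributes a vertex of its own.
\<close>

section \<open>Non-backtracking walks\<close>

fun non_backtracking :: "'a rel \<Rightarrow> 'a list \<Rightarrow> bool" where
  "non_backtracking E [] = True"
| "non_backtracking E [x] = True"
| "non_backtracking E [x, y] = ((x, y) \<in> E)"
| "non_backtracking E (x # y # z # p) = ((x, y) \<in> E \<and> x \<noteq> z \<and> non_backtracking E (y # z # p))"

lemma non_backtracking_ConsD: "non_backtracking E (x # p) \<Longrightarrow> non_backtracking E p"
  by (cases "(E, x # p)" rule: non_backtracking.cases) auto

lemma non_backtracking_Cons2D: "non_backtracking E (x # y # p) \<Longrightarrow> (x, y) \<in> E"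
  by (cases p) auto

lemma non_backtracking_appendD: "non_backtracking E (p @ q) \<Longrightarrow> non_backtracking E q"
  by (induction p) (auto dest: non_backtracking_ConsD)

lemma non_backtracking_butlast: "non_backtracking E p \<Longrightarrow> non_backtracking E (butlast p)"
  by (induction E p rule: non_backtracking.induct) (auto split: if_splits)

lemma vwalk_arcs_subset_if_non_backtracking:
  "non_backtracking E p \<Longrightarrow> set (vwalk_arcs p) \<subseteq> E"
  by (induction E p rule: non_backtracking.induct) auto

text \<open>
  Two walks that leave a vertex \<open>x\<close> along different edges form a single walk through \<open>x\<close>. The
  induction shifts the vertex at which they are joined.
\<close>

lemma non_backtracking_join:
  assumes "sym E" "non_backtracking E (x # a # p)" "non_backtracking E (x # b # q)" "a \<noteq> b"
  shows "non_backtracking E (rev p @ [a, x, b] @ q)"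
  using assms(2-)
proof (induction p arbitrary: x a b q)
  case Nil
  then show ?case using \<open>sym E\<close> by (auto dest: symD)
next
  case (Cons c p)
  have "(a, x) \<in> E" using Cons.prems(1) \<open>sym E\<close> by (auto dest: symD)
  then have "non_backtracking E (a # x # b # q)" using Cons.prems by simp
  moreover have "non_backtracking E (a # c # p)" "c \<noteq> x" using Cons.prems(1) by auto
  ultimately have "non_backtracking E (rev p @ [c, a, x] @ (b # q))" by (intro Cons.IH)
  then show ?case by simp
qed

section \<open>Short walks in a graph of given girth\<close>

context pair_graph
begin

text \<open>
  Once the tail of the walk is known to be repetition-free, only the first vertex \<open>x\<close> can recur,
  and the segment between its two occurrences is a cycle. It has length at least 3: length 1 would
  be a loop, length 2 would be backtracking.
\<close>

lemma distinct_if_non_backtracking: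
  assumes "non_backtracking (parcs G) p" "enat (length p) \<le> girth G"
  shows "distinct p"
  using assms
proof (induction p)
  case Nil
  then show ?case by simp
next
  case (Cons x p)
  have "enat (length p) \<le> girth G"
    by (rule order_trans[OF _ Cons.prems(2)]) simp
  then have dist: "distinct p"
    using Cons.IH non_backtracking_ConsD[OF Cons.prems(1)] by simp
  show ?case
  proof (rule ccontr)
    assume "\<not> distinct (x # p)"
    then obtain ys zs where p: "p = ys @ x # zs" using dist by (auto simp: in_set_conv_decomp)
    let ?c = "vwalk_arcs (x # ys @ [x])"
    have nb: "non_backtracking (parcs G) (x # ys @ x # zs)" using Cons.prems p by simp
    have len: "length ?c = Suc (length ys)"
      using vwalk_length_simp[of "x # ys @ [x]"] unfolding vwalk_length_def by simp
    have "ys \<noteq> []"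
      using nb by (auto dest!: non_backtracking_Cons2D no_loops')
    moreover have "ys \<noteq> [y]" for y using nb by auto
    ultimately have "2 \<le> length ys" by (cases ys rule: remdups_adj.cases) auto
    have "set ?c \<subseteq> set (vwalk_arcs ((x # ys @ [x]) @ zs))" by (rule set_vwalk_arcs_append1)
    then have arcs: "set ?c \<subseteq> parcs G"
      using vwalk_arcs_subset_if_non_backtracking[OF nb] by auto
    have pcas: "pcas u (vwalk_arcs (u # us)) (last (u # us))
        \<and> pawalk_verts u (vwalk_arcs (u # us)) = u # us" for u us
      by (induction us arbitrary: u) auto
    have "?c \<noteq> []" using len by auto
    moreover have "awalk x ?c x"
      using arcs pcas[of x "ys @ [x]"] len
      by (cases ys) (auto simp: awalk_def dest: in_arcsD1)
    moreover have "distinct (tl (pawalk_verts x ?c))"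
      using pcas[of x "ys @ [x]"] dist p by auto
    ultimately have "cycle ?c" unfolding cycle_def by auto
    then have "girth G \<le> enat (length ?c)"
      unfolding girth_def using len \<open>2 \<le> length ys\<close> by (intro INF_lower) auto
    then have "enat (length (x # p)) \<le> enat (length ?c)" using Cons.prems(2) order_trans by blast
    then show False using len p by simp
  qed
qed

text \<open>
  Walks are listed from their end back to their root, so that they are extended by
  \<open>Cons\<close> and a common final segment is removed by structural induction. Where the two walks
  differ for the first time, seen from the end, they are joined to a closed walk that does not
  backtrack. The end is shared by the two lists, so this walk has \<open>length p + length q - 1\<close>
  vertices.
\<close>

lemma non_backtracking_walk_unique:
  assumes "non_backtracking (parcs G) p" "non_backtracking (parcs G) q"
    and "p \<noteq> []" "q \<noteq> []" "hd p = hd q" "last p = last q"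
    and "enat (length p + length q) \<le> girth G + 1"
  shows "p = q"
proof -
  have singleton: "w = [x]"
    if "non_backtracking (parcs G) w" "w \<noteq> []" "hd w = x" "last w = x"
      "enat (Suc (length w)) \<le> girth G + 1" for w x
  proof -
    have "enat (length w) \<le> girth G"
      using that(5) by (cases "girth G") (auto simp: one_enat_def)
    then have "distinct w" using distinct_if_non_backtracking that by blast
    then show ?thesis using that by (cases w) (auto split: if_splits)
  qed
  show ?thesis using assms
  proof (induction p arbitrary: q)
    case Nil
    then show ?case by simp
  next
    case (Cons x p q)
    show ?case
    proof (cases "p = [] \<or> tl q = []")
      case True
      then show ?thesis
      proof
        assume "p = []"
        have "q = [x]" by (rule singleton) (use Cons.prems \<open>p = []\<close> in auto)
        then show ?thesis using \<open>p = []\<close> by simp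
      next
        assume "tl q = []"
        then have "q = [x]" using Cons.prems by (cases q) auto
        have "x # p = [x]" by (rule singleton) (use Cons.prems \<open>q = [x]\<close> in auto)
        then show ?thesis using \<open>q = [x]\<close> by simp
      qed
    next
      case False
      then obtain a p' b q' where p: "p = a # p'" and q: "q = x # b # q'"
        using Cons.prems by (cases p; cases q; cases "tl q") auto
      show ?thesis
      proof (cases "a = b")
        case True
        have "enat (length p + length (b # q')) \<le> enat (length (x # p) + length q)"
          using q by simp
        then have "enat (length p + length (b # q')) \<le> girth G + 1"
          using Cons.prems(7) order_trans by blast
        then have "p = b # q'"
          using Cons.prems p q True by (intro Cons.IH) (auto dest: non_backtracking_ConsD)
        then show ?thesis using q by simp
      next
        case False
        let ?w = "rev p' @ [a, x, b] @ q'"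
        have "sym (parcs G)" using arcs_symmetric by (auto intro: symI)
        then have "non_backtracking (parcs G) ?w"
          using non_backtracking_join Cons.prems False p q by metis
        moreover have "enat (length ?w) \<le> girth G"
          using Cons.prems(7) p q by (cases "girth G") (auto simp: one_enat_def)
        ultimately have "distinct ?w" by (rule distinct_if_non_backtracking)
        moreover have "last (a # p') = last (b # q')" using Cons.prems p q by simp
        then have "last (a # p') \<in> set (a # p') \<inter> set (b # q')"
          by (metis IntI last_in_set list.distinct(1))
        ultimately show ?thesis by auto
      qed
    qed
  qed
qed

end

section \<open>Counting the extensions of walks\<close>

definition extensions :: "'a rel \<Rightarrow> 'a list set \<Rightarrow> 'a list set" where
  "extensions E A = {y # p | y p. p \<in> A \<and> non_backtracking E (y # p)}"

lemma extensions_Un: "extensions E (A \<union> B) = extensions E A \<union> extensions E B"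
  by (auto simp: extensions_def)

lemma extensions_vertex: "sym E \<Longrightarrow> extensions E {[v]} = (\<lambda>w. [w, v]) ` (E `` {v})"
  by (auto simp: extensions_def dest: symD)

lemma extensions_arc:
  "sym E \<Longrightarrow> (u, v) \<in> E \<Longrightarrow> extensions E {[u, v]} = (\<lambda>w. [w, u, v]) ` (E `` {u} - {v})"
  by (auto simp: extensions_def dest: symD)

lemma iterated_extensions:
  assumes "p \<in> (extensions E ^^ i) A"
  shows "\<exists>q\<in>A. \<exists>p'. length p' = i \<and> p = p' @ q \<and> (p' \<noteq> [] \<longrightarrow> non_backtracking E p)"
  using assms
proof (induction i arbitrary: p)
  case 0
  then show ?case by auto
next
  case (Suc i)
  then obtain y p1 where p: "p = y # p1" "p1 \<in> (extensions E ^^ i) A" "non_backtracking E p"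
    using extensions_def[of E "(extensions E ^^ i) A"] by auto
  from Suc.IH[OF p(2)] obtain q p' where "q \<in> A" "length p' = i" "p1 = p' @ q" by auto
  then show ?case using p by (intro bexI[of _ q] exI[of _ "y # p'"]) auto
qed

lemma finite_extensions:
  assumes "finite E" "finite A" "[] \<notin> A"
  shows "finite (extensions E A)"
proof (rule finite_subset)
  show "extensions E A \<subseteq> (\<lambda>(y, p). y # p) ` (fst ` E \<times> A)"
  proof
    fix w assume "w \<in> extensions E A"
    then obtain y p where w: "w = y # p" "p \<in> A" "non_backtracking E (y # p)"
      by (auto simp: extensions_def)
    then obtain x p' where "p = x # p'" using assms(3) by (cases p) auto
    then have "y \<in> fst ` E" using w(3) by (force dest: non_backtracking_Cons2D)
    then show "w \<in> (\<lambda>(y, p). y # p) ` (fst ` E \<times> A)" using w by force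
  qed
qed (use assms in auto)

text \<open>A walk that has arrived along an edge can go on along any other edge at its end.\<close>

lemma card_extensions:
  assumes "finite E" "sym E" "finite A"
    and "\<And>p. p \<in> A \<Longrightarrow> non_backtracking E p \<and> 2 \<le> length p"
  shows "card (extensions E A) = (\<Sum>p\<in>A. card (E `` {hd p}) - 1)"
proof -
  let ?X = "\<lambda>p. (\<lambda>y. y # p) ` (E `` {hd p} - {hd (tl p)})"
  have fin: "finite (E `` {x})" for x using \<open>finite E\<close> by (rule finite_Image)
  have nb_iff: "non_backtracking E (y # p) \<longleftrightarrow> y \<in> E `` {hd p} - {hd (tl p)}"
    and arc: "(hd p, hd (tl p)) \<in> E" if "p \<in> A" for y p
  proof -
    from assms(4)[OF that] obtain a b p' where p: "p = a # b # p'"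
      by (cases p; cases "tl p") auto
    show "non_backtracking E (y # p) \<longleftrightarrow> y \<in> E `` {hd p} - {hd (tl p)}"
      using assms(4)[OF that] \<open>sym E\<close> p by (auto dest: symD)
    show "(hd p, hd (tl p)) \<in> E"
      using assms(4)[OF that] p by (auto dest: non_backtracking_Cons2D)
  qed
  have "extensions E A = (\<Union>p\<in>A. ?X p)" using nb_iff by (auto simp: extensions_def)
  moreover have "card (\<Union>p\<in>A. ?X p) = (\<Sum>p\<in>A. card (?X p))"
    by (intro card_UN_disjoint) (use fin \<open>finite A\<close> in auto)
  moreover have "card (?X p) = card (E `` {hd p}) - 1" if "p \<in> A" for p
    using arc[OF that] fin by (subst card_image) (auto simp: inj_on_def)
  ultimately show ?thesis by simp
qed

text \<open>
  Only the edge along which a walk has arrived is excluded for its next step, so each walk with an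
  edge has at least \<open>r - 1\<close> extensions, and the levels grow at least geometrically.
\<close>

lemma sum_card_iterated_extensions_ge:
  assumes E: "finite E" "sym E" and "finite A"
    and A: "\<And>p. p \<in> A \<Longrightarrow> non_backtracking E p \<and> 2 \<le> length p"
    and deg: "\<And>x y. (x, y) \<in> E \<Longrightarrow> r \<le> card (E `` {x})"
  shows "card A * (\<Sum>i\<le>m. (r - 1) ^ i) \<le> (\<Sum>i\<le>m. card ((extensions E ^^ i) A))"
proof -
  let ?W = "\<lambda>i. (extensions E ^^ i) A"
  have walk: "non_backtracking E p \<and> 2 \<le> length p" if "p \<in> ?W i" for p i
    using iterated_extensions[OF that] A by fastforce
  have fin: "finite (?W i)" for i
  proof (induction i)
    case (Suc i)
    have "[] \<notin> ?W i" using walk[of "[]" i] by auto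
    then show ?case using Suc E(1) by (simp add: finite_extensions)
  qed (use \<open>finite A\<close> in simp)
  have "card A * (r - 1) ^ i \<le> card (?W i)" for i
  proof (induction i)
    case (Suc i)
    have hd_deg: "r \<le> card (E `` {hd p})" if "p \<in> ?W i" for p
    proof -
      from walk[OF that] obtain a b p' where p: "p = a # b # p'"
        by (cases p; cases "tl p") auto
      then show ?thesis using walk[OF that] deg by (auto dest: non_backtracking_Cons2D)
    qed
    have "card A * (r - 1) ^ Suc i \<le> card (?W i) * (r - 1)"
      using mult_right_mono[OF Suc, of "r - 1"] by (simp add: ac_simps)
    also have "\<dots> \<le> (\<Sum>p\<in>?W i. card (E `` {hd p}) - 1)"
      using sum_bounded_below[of "?W i" "r - 1" "\<lambda>p. card (E `` {hd p}) - 1"] hd_deg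
      by (simp add: diff_le_mono)
    also have "\<dots> = card (?W (Suc i))"
      using card_extensions[OF E fin walk] by simp
    finally show ?case .
  qed simp
  then show ?thesis by (auto simp: sum_distrib_left intro: sum_mono)
qed

section \<open>The tree around a vertex and around an edge\<close>

context pair_graph
begin

lemma parcs_sym: "sym (parcs G)"
  using arcs_symmetric by (auto intro: symI)

lemma out_degree_conv: "out_degree (with_proj G) v = card (parcs G `` {v})"
proof -
  have "out_arcs (with_proj G) v = Pair v ` (parcs G `` {v})" by (auto simp: out_arcs_def)
  then show ?thesis unfolding out_degree_def by (simp add: card_image inj_on_def)
qed

text \<open>
  The levels of the tree are disjoint because their walks have different lengths, so only the
  injectivity of the end vertex is at stake.
\<close>

lemma sum_card_levels_le:
  assumes A: "\<And>p. p \<in> A \<Longrightarrow> non_backtracking (parcs G) p \<and> length p = Suc l \<and> hd p \<in> pverts G"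
    and inj: "inj_on hd (\<Union>i\<le>k. (extensions (parcs G) ^^ i) A)"
  shows "(\<Sum>i\<le>k. card ((extensions (parcs G) ^^ i) A)) \<le> card (pverts G)"
proof -
  let ?W = "\<lambda>i. (extensions (parcs G) ^^ i) A"
  have len: "length p = Suc l + i" if "p \<in> ?W i" for p i
    using iterated_extensions[OF that] A by fastforce
  have hd: "hd p \<in> pverts G" if p: "p \<in> ?W i" for p i
  proof (cases i)
    case 0
    then show ?thesis using p A by auto
  next
    case (Suc j)
    then obtain a b p' where "p = a # b # p'"
      using len[OF p] by (cases p; cases "tl p") auto
    then show ?thesis using iterated_extensions[OF p] Suc
      by (auto dest!: non_backtracking_Cons2D dest: in_arcsD1)
  qed
  have sub: "hd ` (\<Union>i\<le>k. ?W i) \<subseteq> pverts G" using hd by auto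
  have fin: "finite (\<Union>i\<le>k. ?W i)"
    using inj sub pair_finite_verts finite_imageD finite_subset by metis
  have disj: "?W i \<inter> ?W j = {}" if "i \<noteq> j" for i j
    using that len[of _ i] len[of _ j] by fastforce
  have "(\<Sum>i\<le>k. card (?W i)) = card (\<Union>i\<le>k. ?W i)"
    using fin disj by (intro card_UN_disjoint[symmetric]) auto
  also have "\<dots> = card (hd ` (\<Union>i\<le>k. ?W i))" using inj by (simp add: card_image)
  also have "\<dots> \<le> card (pverts G)" using sub pair_finite_verts by (rule card_mono[rotated])
  finally show ?thesis .
qed

lemma vertex_levels_le:
  assumes "v \<in> pverts G" "enat (2 * k + 1) \<le> girth G"
  shows "(\<Sum>i\<le>k. card ((extensions (parcs G) ^^ i) {[v]})) \<le> card (pverts G)"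
proof (rule sum_card_levels_le[where l = 0 and A = "{[v]}" and k = k])
  have walk: "non_backtracking (parcs G) p \<and> p \<noteq> [] \<and> last p = v \<and> length p \<le> Suc k"
    if "p \<in> (\<Union>i\<le>k. (extensions (parcs G) ^^ i) {[v]})" for p
    using that by (auto dest!: iterated_extensions)
  show "inj_on hd (\<Union>i\<le>k. (extensions (parcs G) ^^ i) {[v]})"
  proof (rule inj_onI)
    fix p q
    assume p: "p \<in> (\<Union>i\<le>k. (extensions (parcs G) ^^ i) {[v]})"
      and q: "q \<in> (\<Union>i\<le>k. (extensions (parcs G) ^^ i) {[v]})" and "hd p = hd q"
    have "length p + length q \<le> (2 * k + 1) + 1" using walk[OF p] walk[OF q] by auto
    then have "enat (length p + length q) \<le> girth G + 1"
      using assms(2) by (cases "girth G") (auto simp: one_enat_def)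
    then show "p = q"
      using walk[OF p] walk[OF q] \<open>hd p = hd q\<close> by (intro non_backtracking_walk_unique) auto
  qed
qed (use assms(1) in simp)

text \<open>
  Here the walks start with one of the two arcs of the edge. Without its first vertex, a walk
  starting with \<open>(u, v)\<close> is rooted in \<open>v\<close>. Two walks with the same first arc may together be as
  long as the girth, but both can be shortened. For walks starting with opposite arcs, shortening
  one of them gives both the same root and brings the total length below the girth.
\<close>

lemma edge_levels_le:
  assumes "(u, v) \<in> parcs G" "enat (2 * k + 2) \<le> girth G"
  shows "(\<Sum>i\<le>k. card ((extensions (parcs G) ^^ i) {[u, v], [v, u]})) \<le> card (pverts G)"
proof -
  let ?W = "\<Union>i\<le>k. (extensions (parcs G) ^^ i) {[u, v], [v, u]}"
  have arc: "(v, u) \<in> parcs G" using assms arcs_symmetric by auto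
  have walk: "non_backtracking (parcs G) p" "\<exists>p'. length p' \<le> k \<and> (p = p' @ [u, v] \<or> p = p' @ [v, u])"
    if "p \<in> ?W" for p
  proof -
    from that obtain i where "i \<le> k" and i: "p \<in> (extensions (parcs G) ^^ i) {[u, v], [v, u]}" by auto
    from iterated_extensions[OF i] \<open>i \<le> k\<close> obtain q p'
      where "q = [u, v] \<or> q = [v, u]" "length p' \<le> k" "p = p' @ q"
        "p' \<noteq> [] \<longrightarrow> non_backtracking (parcs G) p"
      by blast
    then show "non_backtracking (parcs G) p"
      and "\<exists>p'. length p' \<le> k \<and> (p = p' @ [u, v] \<or> p = p' @ [v, u])"
      using assms(1) arc by auto
  qed
  have inj: "inj_on hd ?W"
  proof (rule inj_onI)
    fix p q assume p: "p \<in> ?W" and q: "q \<in> ?W" and hd: "hd p = hd q"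
    have same: "p = q"
      if "p = p' @ [x, y]" "q = q' @ [x, y]" "length p' \<le> k" "length q' \<le> k" for x y p' q'
    proof -
      have "enat (length (p' @ [x]) + length (q' @ [x])) \<le> girth G + 1"
        using assms(2) that by (cases "girth G") (auto simp: one_enat_def)
      moreover have "non_backtracking (parcs G) (p' @ [x])" "non_backtracking (parcs G) (q' @ [x])"
        using non_backtracking_butlast[OF walk(1)[OF p]] non_backtracking_butlast[OF walk(1)[OF q]]
          that by (auto simp: butlast_append)
      moreover have "hd (p' @ [x]) = hd (q' @ [x])" using hd that by (auto simp: hd_append split: if_splits)
      ultimately have "p' @ [x] = q' @ [x]" by (intro non_backtracking_walk_unique) auto
      then show ?thesis using that by simp
    qed
    have opposite: False
      if "p = p' @ [x, y]" "q = q' @ [y, x]" "length p' \<le> k" "length q' \<le> k" for x y p' q'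
    proof -
      have "enat (length p + length (q' @ [y])) \<le> girth G + 1"
        using assms(2) that by (cases "girth G") (auto simp: one_enat_def)
      moreover have "non_backtracking (parcs G) (q' @ [y])"
        using non_backtracking_butlast[OF walk(1)[OF q]] that by (auto simp: butlast_append)
      moreover have "hd p = hd (q' @ [y])" using hd that by (auto simp: hd_append split: if_splits)
      ultimately have "p = q' @ [y]"
        using walk(1)[OF p] that by (intro non_backtracking_walk_unique) auto
      then have "q = p' @ [x, y, x]" using that by simp
      then show False using walk(1)[OF q] non_backtracking_appendD[of _ p' "[x, y, x]"] by auto
    qed
    from walk(2)[OF p] walk(2)[OF q] show "p = q" using same opposite by blast
  qed
  show ?thesis
  proof (rule sum_card_levels_le[OF _ inj])
    fix p assume "p \<in> {[u, v], [v, u]}"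
    then consider "p = [u, v]" | "p = [v, u]" by blast
    then show "non_backtracking (parcs G) p \<and> length p = Suc 1 \<and> hd p \<in> pverts G"
      using assms(1) arc in_arcsD1 by cases simp_all
  qed
qed

end

section \<open>Many edges between vertices of large degree\<close>

text \<open>The degree of \<open>u\<close> in the subgraph induced by \<open>S\<close>.\<close>

definition inner_degree :: "'a rel \<Rightarrow> 'a set \<Rightarrow> 'a \<Rightarrow> nat" where
  "inner_degree E S u = card (E `` {u} \<inter> S)"

text \<open>
  Double counting of the edges between \<open>S\<close> and \<open>R\<close>: every vertex of \<open>R\<close> meets at most \<open>r\<close> of
  them, and \<open>R\<close> is not larger than \<open>S\<close>.
\<close>

lemma sum_inner_degree_ge:
  assumes "finite E" "sym E" "finite S" "finite R" "S \<inter> R = {}" "card R \<le> card S"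
    and "Field E \<subseteq> S \<union> R"
    and "\<And>u. u \<in> S \<Longrightarrow> card (E `` {u}) = s" "\<And>w. w \<in> R \<Longrightarrow> card (E `` {w}) = r"
  shows "int (card S) * (int s - int r) \<le> (\<Sum>u\<in>S. int (inner_degree E S u))"
proof -
  have fin: "finite (E `` {x})" for x using \<open>finite E\<close> by (rule finite_Image)
  have split: "card (E `` {u} \<inter> S) + card {w \<in> R. (u, w) \<in> E} = s" if "u \<in> S" for u
  proof -
    have "E `` {u} = (E `` {u} \<inter> S) \<union> {w \<in> R. (u, w) \<in> E}"
      using assms(7) by (auto simp: Field_def)
    moreover have "card ((E `` {u} \<inter> S) \<union> {w \<in> R. (u, w) \<in> E})
        = card (E `` {u} \<inter> S) + card {w \<in> R. (u, w) \<in> E}"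
      using assms(4,5) fin by (intro card_Un_disjoint) auto
    ultimately show ?thesis using assms(8)[OF that] by simp
  qed
  have "(\<Sum>u\<in>S. card {w \<in> R. (u, w) \<in> E}) = (\<Sum>w\<in>R. card {u \<in> S. (u, w) \<in> E})"
    using assms(3,4) by (intro sum_multicount_gen) auto
  also have "\<dots> \<le> (\<Sum>w\<in>R. r)"
  proof (rule sum_mono)
    fix w assume "w \<in> R"
    have "{u \<in> S. (u, w) \<in> E} \<subseteq> E `` {w}" using assms(2) by (auto dest: symD)
    then show "card {u \<in> S. (u, w) \<in> E} \<le> r" using card_mono[OF fin] assms(9)[OF \<open>w \<in> R\<close>] by metis
  qed
  also have "\<dots> \<le> card S * r" using assms(6) by simp
  finally have "(\<Sum>u\<in>S. card {w \<in> R. (u, w) \<in> E}) \<le> card S * r" .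
  moreover have "(\<Sum>u\<in>S. inner_degree E S u) + (\<Sum>u\<in>S. card {w \<in> R. (u, w) \<in> E}) = card S * s"
    using split by (simp add: inner_degree_def flip: sum.distrib)
  ultimately have "card S * s \<le> (\<Sum>u\<in>S. inner_degree E S u) + card S * r" by linarith
  then have "int (card S * s) \<le> int ((\<Sum>u\<in>S. inner_degree E S u) + card S * r)" by (simp only: of_nat_le_iff)
  then show ?thesis by (simp add: algebra_simps)
qed

lemma exists_ge_average:
  fixes f :: "'a \<Rightarrow> int"
  assumes "finite S" "S \<noteq> {}" "int (card S) * c \<le> sum f S"
  shows "\<exists>u\<in>S. c \<le> f u"
proof (rule ccontr)
  assume "\<not> ?thesis"
  then have "sum f S < (\<Sum>u\<in>S. c)" using assms by (intro sum_strict_mono) auto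
  then show False using assms by simp
qed

text \<open>
  Summed over the arcs inside \<open>S\<close>, the inner degree of either end gives the sum of the squared
  inner degrees \<open>a u\<close>. If \<open>a u + a v - 2 * c\<close> were negative for all arcs, its sum
  \<open>2 * (\<Sum>u\<in>S. a u * (a u - c))\<close> would be at most minus the number of arcs, hence
  negative. But \<open>a * (a - c) = (a - c)\<^sup>2 + c * (a - c)\<close> and the average of the inner degrees is at
  least \<open>c\<close>, so it is not negative.
\<close>

lemma exists_heavy_edge:
  assumes "finite E" "sym E" "finite S" "S \<noteq> {}" "0 < c"
    and avg: "int (card S) * c \<le> (\<Sum>u\<in>S. int (inner_degree E S u))"
  shows "\<exists>u\<in>S. \<exists>v\<in>S. (u, v) \<in> E \<and> 2 * c \<le> int (inner_degree E S u) + int (inner_degree E S v)"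
proof (rule ccontr)
  assume contra: "\<not> ?thesis"
  define a where "a = (\<lambda>u. int (inner_degree E S u))"
  define N where "N = (\<lambda>u. {v \<in> S. (u, v) \<in> E})"
  have cardN: "int (card (N u)) = a u" for u
    by (auto simp: a_def inner_degree_def N_def intro!: arg_cong[where f = card])
  have "(\<Sum>u\<in>S. \<Sum>v\<in>N u. a v) = (\<Sum>v\<in>S. \<Sum>u | u \<in> S \<and> (u, v) \<in> E. a v)"
    unfolding N_def using \<open>finite S\<close> by (intro sum.swap_restrict) auto
  also have "\<dots> = (\<Sum>v\<in>S. \<Sum>u\<in>N v. a v)"
    unfolding N_def using \<open>sym E\<close> by (intro sum.cong) (auto dest: symD)
  finally have swap: "(\<Sum>u\<in>S. \<Sum>v\<in>N u. a v) = (\<Sum>u\<in>S. a u * a u)" by (simp add: cardN)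
  have "(\<Sum>u\<in>S. \<Sum>v\<in>N u. a u + a v - 2 * c)
      = (\<Sum>u\<in>S. (\<Sum>v\<in>N u. a v) + a u * (a u - 2 * c))"
    by (intro sum.cong) (auto simp: sum.distrib sum_subtractf cardN algebra_simps)
  also have "\<dots> = (\<Sum>u\<in>S. a u * a u + a u * (a u - 2 * c))"
    using swap by (simp add: sum.distrib)
  also have "\<dots> = (\<Sum>u\<in>S. 2 * ((a u - c)\<^sup>2 + c * (a u - c)))"
    by (intro sum.cong) (auto simp: power2_eq_square algebra_simps)
  also have "\<dots> = 2 * ((\<Sum>u\<in>S. (a u - c)\<^sup>2) + c * (sum a S - int (card S) * c))"
    by (simp add: sum_distrib_left[symmetric] sum.distrib sum_subtractf)
  also have "\<dots> \<ge> 0"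
    using avg \<open>0 < c\<close> by (auto simp: a_def intro!: add_nonneg_nonneg sum_nonneg mult_nonneg_nonneg)
  finally have "0 \<le> (\<Sum>u\<in>S. \<Sum>v\<in>N u. a u + a v - 2 * c)" .
  moreover have "(\<Sum>u\<in>S. \<Sum>v\<in>N u. a u + a v - 2 * c) \<le> (\<Sum>u\<in>S. \<Sum>v\<in>N u. - 1)"
    using contra by (intro sum_mono) (force simp: a_def N_def not_le)
  moreover have "(\<Sum>u\<in>S. \<Sum>v\<in>N u. - 1) = - sum a S" by (simp add: cardN sum_negf)
  moreover have "0 < int (card S) * c" using assms by (simp add: card_gt_0_iff)
  ultimately show False using avg by (simp add: a_def)
qed

text \<open>Each neighbour contributes \<open>r - 1\<close>, and those in \<open>S\<close> contribute \<open>s - r\<close> more.\<close>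

lemma sum_neighbour_degrees:
  assumes "finite E" "Field E \<subseteq> S \<union> R" "S \<inter> R = {}" "1 \<le> r" "1 \<le> s"
    and "\<And>u. u \<in> S \<Longrightarrow> card (E `` {u}) = s" "\<And>w. w \<in> R \<Longrightarrow> card (E `` {w}) = r"
    and "u \<in> S"
  shows "int (\<Sum>w\<in>E `` {u}. card (E `` {w}) - 1)
    = int s * (int r - 1) + int (inner_degree E S u) * (int s - int r)"
proof -
  have fin: "finite (E `` {u})" using \<open>finite E\<close> by (rule finite_Image)
  have diff: "E `` {u} - S \<subseteq> R" using assms(2) by (auto simp: Field_def)
  have "int (\<Sum>w\<in>E `` {u}. card (E `` {w}) - 1)
      = (\<Sum>w\<in>E `` {u} \<inter> S. int (card (E `` {w}) - 1)) + (\<Sum>w\<in>E `` {u} - S. int (card (E `` {w}) - 1))"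
    using sum.Int_Diff[OF fin, of "\<lambda>w. int (card (E `` {w}) - 1)" S] by simp
  also have "(\<Sum>w\<in>E `` {u} \<inter> S. int (card (E `` {w}) - 1)) = (\<Sum>w\<in>E `` {u} \<inter> S. int s - 1)"
    using assms by (intro sum.cong) auto
  also have "(\<Sum>w\<in>E `` {u} - S. int (card (E `` {w}) - 1)) = (\<Sum>w\<in>E `` {u} - S. int r - 1)"
    using assms diff by (intro sum.cong) (auto simp: subset_iff)
  finally have *: "int (\<Sum>w\<in>E `` {u}. card (E `` {w}) - 1)
      = int (card (E `` {u} \<inter> S)) * (int s - 1) + int (card (E `` {u} - S)) * (int r - 1)"
    by simp
  have "card (E `` {u} \<inter> S) + card (E `` {u} - S) = s"
    using card_Int_Diff[OF fin] assms(6,8) by metis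
  then have **: "int (card (E `` {u} - S)) = int s - int (card (E `` {u} \<inter> S))" by linarith
  show ?thesis unfolding * ** inner_degree_def by (simp add: algebra_simps)
qed

section \<open>The bound for balanced biregular graphs\<close>

text \<open>
  Levels 0 and 1 are counted exactly, and \<open>L\<close> is what the choice of the root achieves for level 2.
  From there on only the minimum degree is used.
\<close>

lemma sum_levels_ge:
  assumes E: "finite E" "sym E"
    and A: "finite A" "\<And>p. p \<in> A \<Longrightarrow> non_backtracking E p \<and> length p = Suc l"
    and deg: "\<And>x y. (x, y) \<in> E \<Longrightarrow> r \<le> card (E `` {x})" and "1 \<le> r"
    and L: "L \<le> int (card (extensions E (extensions E A)))"
  shows "int (card A) + int (card (extensions E A)) + L * (\<Sum>i = 0..m. (int r - 1) ^ i)
    \<le> int (\<Sum>i\<le>m + 2. card ((extensions E ^^ i) A))"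
proof -
  let ?W = "\<lambda>i. (extensions E ^^ i) A"
  have walk: "non_backtracking E p \<and> p \<noteq> [] \<and> length p = Suc l + i" if "p \<in> ?W i" for p i
    using iterated_extensions[OF that] A(2) by fastforce
  have fin2: "finite (?W 2)"
  proof -
    have "finite (?W 1)" using E A(1) walk[of _ 0] by (auto intro!: finite_extensions)
    then show ?thesis
      using E walk[of _ 1] by (auto simp: numeral_2_eq_2 intro!: finite_extensions)
  qed
  have "(\<Sum>i\<le>m + 2. card (?W i)) = card A + card (extensions E A) + (\<Sum>i\<le>m. card (?W (i + 2)))"
    by (simp add: sum.atMost_Suc_shift numeral_2_eq_2 del: sum.atMost_Suc)
  moreover have "?W (i + 2) = (extensions E ^^ i) (?W 2)" for i
    unfolding funpow_add by simp
  moreover have "card (?W 2) * (\<Sum>i\<le>m. (r - 1) ^ i) \<le> (\<Sum>i\<le>m. card ((extensions E ^^ i) (?W 2)))"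
    using walk[of _ 2] by (intro sum_card_iterated_extensions_ge[OF E fin2 _ deg]) force+
  ultimately have "card A + card (extensions E A) + card (?W 2) * (\<Sum>i\<le>m. (r - 1) ^ i)
      \<le> (\<Sum>i\<le>m + 2. card (?W i))" by simp
  then have "int (card A + card (extensions E A) + card (?W 2) * (\<Sum>i\<le>m. (r - 1) ^ i))
      \<le> int (\<Sum>i\<le>m + 2. card (?W i))" by (simp only: of_nat_le_iff)
  moreover have "(\<Sum>i = 0..m. (int r - 1) ^ i) = int (\<Sum>i\<le>m. (r - 1) ^ i)"
    using \<open>1 \<le> r\<close> by (simp add: of_nat_diff atMost_atLeast0)
  moreover have "L * int (\<Sum>i\<le>m. (r - 1) ^ i) \<le> int (card (?W 2)) * int (\<Sum>i\<le>m. (r - 1) ^ i)"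
    using L by (intro mult_right_mono[OF _ of_nat_0_le_iff]) (simp add: numeral_2_eq_2)
  ultimately show ?thesis by simp
qed

lemma (in pair_graph) card_second_level_vertex:
  "card (extensions (parcs G) (extensions (parcs G) {[v]}))
    = (\<Sum>w\<in>parcs G `` {v}. card (parcs G `` {w}) - 1)"
proof -
  have "card (extensions (parcs G) (extensions (parcs G) {[v]}))
      = (\<Sum>p\<in>extensions (parcs G) {[v]}. card (parcs G `` {hd p}) - 1)"
    using pair_finite_arcs parcs_sym
    by (intro card_extensions) (auto simp: extensions_vertex dest: symD)
  also have "\<dots> = (\<Sum>w\<in>parcs G `` {v}. card (parcs G `` {w}) - 1)"
    using parcs_sym by (simp add: extensions_vertex sum.reindex inj_on_def)
  finally show ?thesis .
qed

lemma (in pair_graph)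
  assumes "(u, v) \<in> parcs G"
  shows card_first_level_edge: "card (extensions (parcs G) {[u, v], [v, u]})
      = (card (parcs G `` {u}) - 1) + (card (parcs G `` {v}) - 1)" (is ?first)
    and card_second_level_edge: "card (extensions (parcs G) (extensions (parcs G) {[u, v], [v, u]}))
      = (\<Sum>w\<in>parcs G `` {u} - {v}. card (parcs G `` {w}) - 1)
        + (\<Sum>w\<in>parcs G `` {v} - {u}. card (parcs G `` {w}) - 1)" (is ?second)
proof -
  let ?E = "parcs G"
  have arc: "(v, u) \<in> ?E" and "u \<noteq> v" using assms arcs_symmetric no_loops' by auto
  have fin: "finite (?E `` {x})" for x using pair_finite_arcs by (rule finite_Image)
  have "extensions ?E {[u, v], [v, u]} = extensions ?E {[u, v]} \<union> extensions ?E {[v, u]}"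
    unfolding extensions_Un[symmetric] by (simp add: insert_commute)
  then have ext: "extensions ?E {[u, v], [v, u]}
      = (\<lambda>w. [w, u, v]) ` (?E `` {u} - {v}) \<union> (\<lambda>w. [w, v, u]) ` (?E `` {v} - {u})"
    using extensions_arc[OF parcs_sym assms] extensions_arc[OF parcs_sym arc] by simp
  show ?first
    using pair_finite_arcs parcs_sym assms arc \<open>u \<noteq> v\<close> by (subst card_extensions) auto
  have "card (extensions ?E (extensions ?E {[u, v], [v, u]}))
      = (\<Sum>p\<in>extensions ?E {[u, v], [v, u]}. card (?E `` {hd p}) - 1)"
    using assms arc fin parcs_sym
    by (intro card_extensions[OF pair_finite_arcs parcs_sym]) (auto simp: ext dest: symD)
  also have "\<dots> = (\<Sum>p\<in>(\<lambda>w. [w, u, v]) ` (?E `` {u} - {v}). card (?E `` {hd p}) - 1)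
      + (\<Sum>p\<in>(\<lambda>w. [w, v, u]) ` (?E `` {v} - {u}). card (?E `` {hd p}) - 1)"
    unfolding ext using fin \<open>u \<noteq> v\<close> by (intro sum.union_disjoint) auto
  finally show ?second by (simp add: sum.reindex inj_on_def)
qed

theorem theorem3p6:
  fixes r s g :: nat and G :: "'a pair_pre_digraph"
  assumes "2 \<le> r" and "r < s" and "3 \<le> g"
    and "babi_graph r s g G"
  shows "(g = 3 \<longrightarrow> int (card (pverts G)) \<ge> 1 + int s) \<and>
    (g = 4 \<longrightarrow> int (card (pverts G)) \<ge> 2 * int s) \<and>
    (3 < g \<and> odd g \<longrightarrow>
      int (card (pverts G)) \<ge>
        1 + int s + (int r * int s + (int s - int r)\<^sup>2 - int s)
          * (\<Sum>i = 0..(g - 5) div 2. (int r - 1) ^ i)) \<and>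
    (4 < g \<and> even g \<longrightarrow>
      int (card (pverts G)) \<ge>
        2 * (int s + (int r * int s + (int s - int r)\<^sup>2 - 2 * int s + 1)
          * (\<Sum>i = 0..(g - 6) div 2. (int r - 1) ^ i)))"
proof -
  interpret pair_graph G using assms(4) by (simp add: babi_graph_def)
  let ?E = "parcs G"
  have girth: "girth G = enat g" using assms(4) by (simp add: babi_graph_def)
  define S where "S = {v \<in> pverts G. card (?E `` {v}) = s}"
  define R where "R = {v \<in> pverts G. card (?E `` {v}) = r}"
  define a where "a = inner_degree ?E S"
  have img: "(\<lambda>v. card (?E `` {v})) ` pverts G = {r, s}" and "card R = card S"
    using assms(4) by (auto simp: babi_graph_def out_degree_conv R_def S_def)
  have field: "Field ?E \<subseteq> S \<union> R"
    using img in_arcsD1 in_arcsD2 by (fastforce simp: Field_def S_def R_def)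
  have S: "finite S" "S \<noteq> {}" "finite R" "S \<inter> R = {}"
    using pair_finite_verts img assms(2) by (auto simp: S_def R_def)
  have degS: "card (?E `` {u}) = s" if "u \<in> S" for u using that by (simp add: S_def)
  have degR: "card (?E `` {u}) = r" if "u \<in> R" for u using that by (simp add: R_def)
  have deg: "r \<le> card (?E `` {x})" if "(x, y) \<in> ?E" for x y
    using field degS degR assms(2) FieldI1[OF that] by fastforce
  have avg: "int (card S) * (int s - int r) \<le> (\<Sum>u\<in>S. int (a u))"
    unfolding a_def using S field degS degR \<open>card R = card S\<close> pair_finite_arcs parcs_sym
    by (intro sum_inner_degree_ge) auto
  have nbr_sum: "int (\<Sum>w\<in>?E `` {u}. card (?E `` {w}) - 1)
      = int s * (int r - 1) + int (a u) * (int s - int r)" if "u \<in> S" for u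
    unfolding a_def using S field degS degR assms(1,2) pair_finite_arcs that
    by (intro sum_neighbour_degrees) auto

  obtain z where z: "z \<in> S" "int s - int r \<le> int (a z)"
    using exists_ge_average[OF S(1,2) avg] by auto
  have "z \<in> pverts G" using z by (simp add: S_def)
  have level1_z: "card (extensions ?E {[z]}) = s"
    using degS z(1) parcs_sym by (simp add: extensions_vertex card_image inj_on_def)
  have odd_case: "1 + int s + (int r * int s + (int s - int r)\<^sup>2 - int s)
      * (\<Sum>i = 0..m. (int r - 1) ^ i) \<le> int (card (pverts G))" if "g = 2 * m + 5" for m
  proof -
    have "(int s - int r) * (int s - int r) \<le> int (a z) * (int s - int r)"
      using z assms(2) by (intro mult_right_mono) auto
    then have "int r * int s + (int s - int r)\<^sup>2 - int s
        \<le> int (card (extensions ?E (extensions ?E {[z]})))"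
      unfolding card_second_level_vertex nbr_sum[OF z(1)]
      by (simp add: power2_eq_square algebra_simps)
    then have "int (card {[z]}) + int (card (extensions ?E {[z]}))
        + (int r * int s + (int s - int r)\<^sup>2 - int s) * (\<Sum>i = 0..m. (int r - 1) ^ i)
        \<le> int (\<Sum>i\<le>m + 2. card ((extensions ?E ^^ i) {[z]}))"
      using pair_finite_arcs parcs_sym deg assms(1)
      by (intro sum_levels_ge[where l = 0]) auto
    also have "\<dots> \<le> int (card (pverts G))"
      unfolding of_nat_le_iff using \<open>z \<in> pverts G\<close> girth that by (intro vertex_levels_le) auto
    finally show ?thesis using level1_z by simp
  qed

  obtain u v where uv: "u \<in> S" "v \<in> S" "(u, v) \<in> ?E"
    and heavy: "2 * (int s - int r) \<le> int (a u) + int (a v)"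
    using exists_heavy_edge[OF pair_finite_arcs parcs_sym S(1,2), of "int s - int r"] avg assms(2)
    unfolding a_def by auto
  have arc: "(v, u) \<in> ?E" and "u \<noteq> v" using uv arcs_symmetric no_loops' by auto
  have level1_uv: "card (extensions ?E {[u, v], [v, u]}) = 2 * (s - 1)"
    using card_first_level_edge[OF uv(3)] degS uv by simp
  have even_case: "2 * (int s + (int r * int s + (int s - int r)\<^sup>2 - 2 * int s + 1)
      * (\<Sum>i = 0..m. (int r - 1) ^ i)) \<le> int (card (pverts G))" if "g = 2 * m + 6" for m
  proof -
    let ?L = "2 * (int r * int s + (int s - int r)\<^sup>2 - 2 * int s + 1)"
    have fin: "finite (?E `` {x})" for x using pair_finite_arcs by (rule finite_Image)
    (* The other end y of the root edge has degree s, but it is not a child of x. *)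
    have rest: "int (\<Sum>w\<in>?E `` {x} - {y}. card (?E `` {w}) - 1)
        = int s * (int r - 1) + int (a x) * (int s - int r) - (int s - 1)"
      if "x \<in> S" "y \<in> S" "(x, y) \<in> ?E" for x y
    proof -
      have "(\<Sum>w\<in>?E `` {x}. card (?E `` {w}) - 1)
          = (s - 1) + (\<Sum>w\<in>?E `` {x} - {y}. card (?E `` {w}) - 1)"
        using sum.remove[OF fin, of y x "\<lambda>w. card (?E `` {w}) - 1"] that degS by simp
      then have "int (\<Sum>w\<in>?E `` {x}. card (?E `` {w}) - 1)
          = int (s - 1) + int (\<Sum>w\<in>?E `` {x} - {y}. card (?E `` {w}) - 1)"
        by (simp only: of_nat_add)
      then show ?thesis unfolding nbr_sum[OF that(1)] using assms(1,2) by (simp add: of_nat_diff)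
    qed
    have "2 * (int s - int r) * (int s - int r) \<le> (int (a u) + int (a v)) * (int s - int r)"
      using heavy assms(2) by (intro mult_right_mono) auto
    then have "?L \<le> int (card (extensions ?E (extensions ?E {[u, v], [v, u]})))"
      unfolding card_second_level_edge[OF uv(3)] of_nat_add rest[OF uv] rest[OF uv(2,1) arc]
      by (simp add: power2_eq_square algebra_simps)
    then have "int (card {[u, v], [v, u]}) + int (card (extensions ?E {[u, v], [v, u]}))
        + ?L * (\<Sum>i = 0..m. (int r - 1) ^ i)
        \<le> int (\<Sum>i\<le>m + 2. card ((extensions ?E ^^ i) {[u, v], [v, u]}))"
      using pair_finite_arcs parcs_sym deg assms(1) uv arc
      by (intro sum_levels_ge[where l = 1]) auto
    also have "\<dots> \<le> int (card (pverts G))"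
      unfolding of_nat_le_iff using uv girth that by (intro edge_levels_le) auto
    finally have "int (card {[u, v], [v, u]}) + int (card (extensions ?E {[u, v], [v, u]}))
        + ?L * (\<Sum>i = 0..m. (int r - 1) ^ i) \<le> int (card (pverts G))" .
    moreover have "card {[u, v], [v, u]} = 2" using \<open>u \<noteq> v\<close> by simp
    ultimately have "2 + 2 * (int s - 1) + ?L * (\<Sum>i = 0..m. (int r - 1) ^ i)
        \<le> int (card (pverts G))"
      using level1_uv assms(1,2) by (simp add: of_nat_diff)
    then show ?thesis by (simp add: algebra_simps)
  qed

  show ?thesis
  proof (intro conjI impI)
    assume "g = 3"
    then have "(\<Sum>i\<le>1. card ((extensions ?E ^^ i) {[z]})) \<le> card (pverts G)"
      using \<open>z \<in> pverts G\<close> girth by (intro vertex_levels_le) auto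
    then show "1 + int s \<le> int (card (pverts G))" using level1_z by simp
  next
    assume "g = 4"
    then have "(\<Sum>i\<le>1. card ((extensions ?E ^^ i) {[u, v], [v, u]})) \<le> card (pverts G)"
      using uv girth by (intro edge_levels_le) auto
    then show "2 * int s \<le> int (card (pverts G))"
      using level1_uv \<open>u \<noteq> v\<close> assms(1,2) by simp
  next
    assume "3 < g \<and> odd g"
    then have "g = 2 * ((g - 5) div 2) + 5" by presburger
    then show "1 + int s + (int r * int s + (int s - int r)\<^sup>2 - int s)
        * (\<Sum>i = 0..(g - 5) div 2. (int r - 1) ^ i) \<le> int (card (pverts G))"
      by (rule odd_case)
  next
    assume "4 < g \<and> even g"
    then have "g = 2 * ((g - 6) div 2) + 6" by presburger
    then show "2 * (int s + (int r * int s + (int s - int r)\<^sup>2 - 2 * int s + 1)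
        * (\<Sum>i = 0..(g - 6) div 2. (int r - 1) ^ i)) \<le> int (card (pverts G))"
      by (rule even_case)
  qed
qed

end
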